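(* Every countably generated semigroup can be embedded into a simple two-generated semigroup. That is, for every semigroup $P$ generated by an at most countable set there exist a simple semigroup $Q$ generated by two elements and an injective semigroup homomorphism $P\to Q$.
   Context: A semigroup $S$ without zero is called simple if it has no proper (two-sided) ideals; equivalently, $SaS=S$ for every $a\in S$. Semigroups are nonempty. *)

theory Defs
  imports "HOL-Algebra.Group" "HOL-Library.Countable_Set"
begin

text \<open>
  Semigroups are carried by the \<^typ>\<open>'a monoid\<close> record, so that \<^const>\<open>hom\<close> and \<^const>\<open>mon\<close>
  are available. Only the fields for the carrier and the multiplication matter: the field for the
  unit is unconstrained, and neither \<^const>\<open>hom\<close> nor \<^const>\<open>mon\<close> refers to it.
\<close>

locale carrier_semigroup =
  fixes S (structure)
  assumes carrier_nonempty: "carrier S \<noteq> {}"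
    and m_closed: "\<lbrakk>x \<in> carrier S; y \<in> carrier S\<rbrakk> \<Longrightarrow> x \<otimes> y \<in> carrier S"
    and m_assoc: "\<lbrakk>x \<in> carrier S; y \<in> carrier S; z \<in> carrier S\<rbrakk> \<Longrightarrow> (x \<otimes> y) \<otimes> z = x \<otimes> (y \<otimes> z)"

inductive_set generated_subsemigroup :: "('a, 'b) monoid_scheme \<Rightarrow> 'a set \<Rightarrow> 'a set"
  for S and X where
    incl: "x \<in> X \<Longrightarrow> x \<in> generated_subsemigroup S X"
  | mult: "\<lbrakk>x \<in> generated_subsemigroup S X; y \<in> generated_subsemigroup S X\<rbrakk>
      \<Longrightarrow> x \<otimes>\<^bsub>S\<^esub> y \<in> generated_subsemigroup S X"

definition countably_generated :: "('a, 'b) monoid_scheme \<Rightarrow> bool" where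
  "countably_generated S \<longleftrightarrow>
    (\<exists>X. X \<subseteq> carrier S \<and> countable X \<and> generated_subsemigroup S X = carrier S)"

text \<open>
  A two-generated semigroup is countable, hence isomorphic to one whose carrier is a set of
  natural numbers: quantifying over two-generated \<^typ>\<open>nat monoid\<close> records covers all of them.
\<close>

definition two_generated :: "('a, 'b) monoid_scheme \<Rightarrow> bool" where
  "two_generated S \<longleftrightarrow>
    (\<exists>a\<in>carrier S. \<exists>b\<in>carrier S. generated_subsemigroup S {a, b} = carrier S)"

definition semigroup_ideal :: "('a, 'b) monoid_scheme \<Rightarrow> 'a set \<Rightarrow> bool" where
  "semigroup_ideal S I \<longleftrightarrow> I \<subseteq> carrier S \<and> I \<noteq> {} \<and>
    (\<forall>s\<in>carrier S. \<forall>x\<in>I. s \<otimes>\<^bsub>S\<^esub> x \<in> I \<and> x \<otimes>\<^bsub>S\<^esub> s \<in> I)"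

definition has_zero :: "('a, 'b) monoid_scheme \<Rightarrow> bool" where
  "has_zero S \<longleftrightarrow>
    (\<exists>z\<in>carrier S. \<forall>s\<in>carrier S. z \<otimes>\<^bsub>S\<^esub> s = z \<and> s \<otimes>\<^bsub>S\<^esub> z = z)"

text \<open>
  A semigroup with at least two elements and no proper ideals has no zero, so the first conjunct
  excludes nothing but the one-element semigroup.
\<close>

definition simple_semigroup :: "('a, 'b) monoid_scheme \<Rightarrow> bool" where
  "simple_semigroup S \<longleftrightarrow>
    \<not> has_zero S \<and> (\<forall>I. semigroup_ideal S I \<longrightarrow> I = carrier S)"

lemma (in carrier_semigroup) no_proper_ideals_iff:
  "(\<forall>I. semigroup_ideal S I \<longrightarrow> I = carrier S) \<longleftrightarrow>
    (\<forall>a\<in>carrier S. {s \<otimes> a \<otimes> t |s t. s \<in> carrier S \<and> t \<in> carrier S} = carrier S)"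
proof
  assume L: "\<forall>I. semigroup_ideal S I \<longrightarrow> I = carrier S"
  show "\<forall>a\<in>carrier S. {s \<otimes> a \<otimes> t |s t. s \<in> carrier S \<and> t \<in> carrier S} = carrier S"
  proof
    fix a assume a: "a \<in> carrier S"
    define I where "I = {s \<otimes> a \<otimes> t |s t. s \<in> carrier S \<and> t \<in> carrier S}"
    have I_intro: "s \<otimes> a \<otimes> t \<in> I" if "s \<in> carrier S" "t \<in> carrier S" for s t
      using that unfolding I_def by blast
    have "semigroup_ideal S I"
      unfolding semigroup_ideal_def
    proof (intro conjI ballI)
      show "I \<subseteq> carrier S" using a m_closed by (auto simp: I_def)
      show "I \<noteq> {}" using I_intro[OF a a] by (metis empty_iff)
    next
      fix u x assume u: "u \<in> carrier S" and "x \<in> I"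
      then obtain s t where st: "s \<in> carrier S" "t \<in> carrier S" and x: "x = s \<otimes> a \<otimes> t"
        unfolding I_def by blast
      have "u \<otimes> x = (u \<otimes> s) \<otimes> a \<otimes> t"
        unfolding x using u st a by (simp add: m_assoc m_closed)
      then show "u \<otimes> x \<in> I" using I_intro[OF m_closed[OF u st(1)] st(2)] by simp
      have "x \<otimes> u = s \<otimes> a \<otimes> (t \<otimes> u)"
        unfolding x using u st a by (simp add: m_assoc m_closed)
      then show "x \<otimes> u \<in> I" using I_intro[OF st(1) m_closed[OF st(2) u]] by simp
    qed
    then show "{s \<otimes> a \<otimes> t |s t. s \<in> carrier S \<and> t \<in> carrier S} = carrier S"
      using L unfolding I_def[symmetric] by simp
  qed
next
  assume R: "\<forall>a\<in>carrier S. {s \<otimes> a \<otimes> t |s t. s \<in> carrier S \<and> t \<in> carrier S} = carrier S"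
  show "\<forall>I. semigroup_ideal S I \<longrightarrow> I = carrier S"
  proof (intro allI impI)
    fix I assume I: "semigroup_ideal S I"
    then obtain a where a: "a \<in> I" "a \<in> carrier S"
      unfolding semigroup_ideal_def by blast
    have "s \<otimes> a \<otimes> t \<in> I" if "s \<in> carrier S" "t \<in> carrier S" for s t
      using I a that unfolding semigroup_ideal_def by simp
    then have "{s \<otimes> a \<otimes> t |s t. s \<in> carrier S \<and> t \<in> carrier S} \<subseteq> I" by auto
    then have "carrier S \<subseteq> I" using bspec[OF R a(2)] by simp
    then show "I = carrier S" using I unfolding semigroup_ideal_def by blast
  qed
qed

end

theory Submission
  imports Defs
begin

text \<open>
  Let the semigroup \<open>Q\<close> consist of maps of \<open>nat \<times> Y\<close>, generated by the shift \<open>c (n, t) = (n + 1, t)\<close>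
  and by \<open>p \<circ> b\<close>, where \<open>b\<close> is a left inverse of \<open>c\<close> acting on level \<open>0\<close> by an arbitrary map
  \<open>\<phi>\<close> of \<open>Y\<close>, and the involution \<open>p\<close> exchanges the levels \<open>0\<close> and \<open>1\<close>, acts on level \<open>2\<close> by an
  arbitrary involution \<open>\<tau>\<close> of \<open>Y\<close>, and fixes all higher levels. Since \<open>p \<circ> b \<circ> c = p\<close>
  and \<open>p \<circ> p = id\<close>, the maps \<open>p\<close>, \<open>b\<close> and \<open>id\<close> lie in \<open>Q\<close>. Every \<open>u\<close> in \<open>Q\<close> is a shift on
  high levels, so \<open>u \<circ> c^L = c^M\<close> for some \<open>L\<close> and \<open>M\<close>; hence \<open>b^M \<circ> u \<circ> c^L = id\<close> and \<open>Q\<close> is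
  simple.

  On level \<open>0\<close> the map \<open>b \<circ> p \<circ> c\<close> acts by \<open>\<phi>\<close>, and \<open>b^2 \<circ> p \<circ> c^2\<close> by \<open>\<tau>\<close>. As in Sierpinski's
  theorem on countable sets of transformations, \<open>\<phi>\<close> and \<open>\<tau>\<close> can be chosen to generate
  any given sequence of maps \<open>f i\<close>: here \<open>\<phi>\<close> either increments a counter or, after \<open>\<tau>\<close> has
  flipped a switch, applies the map selected by the counter. Taking for \<open>f i\<close> the left
  translations of \<open>P\<close> with a unit adjoined gives the embedding.
\<close>

section \<open>Generated subsemigroups and isomorphic copies\<close>

lemma generated_subsemigroup_subset:
  assumes "mult S = mult T"
  shows "generated_subsemigroup S X \<subseteq> generated_subsemigroup T X"
proof
  show "x \<in> generated_subsemigroup T X" if "x \<in> generated_subsemigroup S X" for x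
    using that by induction (auto simp: assms intro: generated_subsemigroup.intros)
qed

lemma generated_subsemigroup_cong:
  assumes "mult S = mult T"
  shows "generated_subsemigroup S X = generated_subsemigroup T X"
  using assms by (metis generated_subsemigroup_subset subset_antisym)

lemma countable_generated_subsemigroup:
  assumes "countable X"
  shows "countable (generated_subsemigroup S X)"
proof -
  \<comment> \<open>\<open>A n\<close> holds the products of bracketing depth at most
    \<open>n\<close>; every stage is countable.\<close>
  define A where "A = rec_nat X (\<lambda>_ B. B \<union> (\<lambda>(x, y). x \<otimes>\<^bsub>S\<^esub> y) ` (B \<times> B))"
  have A_0: "A 0 = X" and A_Suc: "A (Suc n) = A n \<union> (\<lambda>(x, y). x \<otimes>\<^bsub>S\<^esub> y) ` (A n \<times> A n)" for n
    by (simp_all add: A_def)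
  have countable: "countable (A n)" for n
    by (induction n) (auto simp: A_0 A_Suc assms)
  have mono: "A m \<subseteq> A n" if "m \<le> n" for m n
    using that by (rule lift_Suc_mono_le[rotated]) (auto simp: A_Suc)
  have "x \<in> (\<Union>n. A n)" if "x \<in> generated_subsemigroup S X" for x
    using that
  proof induction
    case (incl x)
    then show ?case using A_0 by blast
  next
    case (mult x y)
    then obtain m n where "x \<in> A m" "y \<in> A n" by blast
    then have "x \<in> A (max m n)" "y \<in> A (max m n)"
      using mono[of m "max m n"] mono[of n "max m n"] by auto
    then have "x \<otimes>\<^bsub>S\<^esub> y \<in> A (Suc (max m n))" by (auto simp: A_Suc)
    then show ?case by blast
  qed
  moreover have "countable (\<Union>n. A n)" using countable by blast
  ultimately show ?thesis by (metis countable_subset subsetI)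
qed

text \<open>Moves a countable semigroup of maps to type \<open>nat\<close>: multiplication is
  transported along an injective enumeration of the carrier.\<close>

lemma nat_copy:
  assumes "carrier_semigroup S" and "countable (carrier S)"
  obtains Q :: "nat monoid" and g where "carrier_semigroup Q" and "g \<in> iso S Q"
proof -
  interpret carrier_semigroup S by fact
  define g where "g = to_nat_on (carrier S)"
  define h where "h = inv_into (carrier S) g"
  define Q :: "nat monoid"
    where "Q = \<lparr>carrier = g ` carrier S, mult = \<lambda>m n. g (h m \<otimes>\<^bsub>S\<^esub> h n), one = 0\<rparr>"
  have inj: "inj_on g (carrier S)"
    unfolding g_def by (rule inj_on_to_nat_on) fact
  have h_g: "h (g x) = x" if "x \<in> carrier S" for x
    unfolding h_def using inj that by simp
  have "carrier_semigroup Q"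
    by standard (auto simp: Q_def h_g m_closed m_assoc carrier_nonempty)
  moreover have "g \<in> iso S Q"
    by (auto simp: iso_def hom_def Q_def h_g m_closed bij_betw_def inj)
  ultimately show ?thesis by (rule that)
qed

lemma iso_two_generated:
  assumes "carrier_semigroup S" and "g \<in> iso S Q" and "two_generated S"
  shows "two_generated Q"
proof -
  interpret carrier_semigroup S by fact
  have g: "g \<in> hom S Q" and g_image: "g ` carrier S = carrier Q"
    using assms(2) by (auto simp: iso_def bij_betw_def)
  obtain a b where ab: "a \<in> carrier S" "b \<in> carrier S" "generated_subsemigroup S {a, b} = carrier S"
    using assms(3) unfolding two_generated_def by blast
  have gab: "g a \<in> carrier Q" "g b \<in> carrier Q" using ab g_image by auto
  have mult_Q: "x \<otimes>\<^bsub>Q\<^esub> y \<in> carrier Q" if "x \<in> carrier Q" "y \<in> carrier Q" for x y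
    using that g by (auto simp: g_image[symmetric] hom_mult[symmetric] m_closed)
  have "x \<in> carrier S \<and> g x \<in> generated_subsemigroup Q {g a, g b}"
    if "x \<in> generated_subsemigroup S {a, b}" for x
    using that
    by induction (use ab g in \<open>auto simp: hom_mult m_closed intro: generated_subsemigroup.intros\<close>)
  then have "carrier Q \<subseteq> generated_subsemigroup Q {g a, g b}"
    unfolding ab(3) g_image[symmetric] by blast
  moreover have "x \<in> carrier Q" if "x \<in> generated_subsemigroup Q {g a, g b}" for x
    using that by induction (use gab mult_Q in auto)
  ultimately show ?thesis unfolding two_generated_def using gab by blast
qed

text \<open>By injectivity a zero of \<open>Q\<close> comes from a zero of \<open>S\<close>, and the
  preimage of an ideal under \<open>g\<close> is an ideal.\<close>

lemma iso_simple_semigroup: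
  assumes "carrier_semigroup S" and "g \<in> iso S Q" and "simple_semigroup S"
  shows "simple_semigroup Q"
proof -
  interpret carrier_semigroup S by fact
  have g: "g \<in> hom S Q" and inj: "inj_on g (carrier S)" and g_image: "g ` carrier S = carrier Q"
    using assms(2) by (auto simp: iso_def bij_betw_def)
  have mem: "g x \<in> carrier Q" if "x \<in> carrier S" for x
    using that g_image by auto
  show ?thesis
    unfolding simple_semigroup_def
  proof (intro conjI notI allI impI)
    assume "has_zero Q"
    then obtain z where z: "z \<in> carrier Q"
      and zero: "\<And>s. s \<in> carrier Q \<Longrightarrow> z \<otimes>\<^bsub>Q\<^esub> s = z \<and> s \<otimes>\<^bsub>Q\<^esub> z = z"
      unfolding has_zero_def by blast
    from z obtain w where w: "w \<in> carrier S" "z = g w" using g_image by blast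
    have "w \<otimes>\<^bsub>S\<^esub> s = w \<and> s \<otimes>\<^bsub>S\<^esub> w = w" if "s \<in> carrier S" for s
      using zero[OF mem[OF that]] that w
      by (metis g hom_mult inj inj_onD m_closed)
    then have "has_zero S" using w(1) unfolding has_zero_def by blast
    then show False using assms(3) unfolding simple_semigroup_def by blast
  next
    fix I assume I: "semigroup_ideal Q I"
    define J where "J = {x \<in> carrier S. g x \<in> I}"
    have "semigroup_ideal S J"
      unfolding semigroup_ideal_def
    proof (intro conjI ballI)
      obtain y where "y \<in> I" "y \<in> carrier Q" using I unfolding semigroup_ideal_def by blast
      then show "J \<noteq> {}" using g_image unfolding J_def by (metis (no_types, lifting) empty_iff imageE mem_Collect_eq)
    qed (use I mem in \<open>auto simp: semigroup_ideal_def J_def m_closed hom_mult[OF g]\<close>)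
    then have "J = carrier S" using assms(3) unfolding simple_semigroup_def by blast
    then have "g ` carrier S \<subseteq> I" unfolding J_def by blast
    then show "I = carrier Q"
      using I unfolding g_image semigroup_ideal_def by blast
  qed
qed

section \<open>Maps shifting high levels\<close>

definition transformations :: "('x \<Rightarrow> 'x) monoid" where
  "transformations = \<lparr>carrier = UNIV, mult = (\<circ>), one = id\<rparr>"

lemma mult_transformations [simp]: "u \<otimes>\<^bsub>transformations\<^esub> v = u \<circ> v"
  by (simp add: transformations_def)

text \<open>The identity map is not put into the carrier by hand, so its membership is a separate
  claim.\<close>

definition generated_transformations :: "('x \<Rightarrow> 'x) set \<Rightarrow> ('x \<Rightarrow> 'x) monoid" where
  "generated_transformations X =
    transformations\<lparr>carrier := generated_subsemigroup transformations X\<rparr>"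

lemma mult_generated_transformations [simp]: "u \<otimes>\<^bsub>generated_transformations X\<^esub> v = u \<circ> v"
  by (simp add: generated_transformations_def)

lemma generated_transformations_incl: "u \<in> X \<Longrightarrow> u \<in> carrier (generated_transformations X)"
  by (simp add: generated_transformations_def generated_subsemigroup.incl)

lemma generated_transformations_comp:
  assumes "u \<in> carrier (generated_transformations X)" "v \<in> carrier (generated_transformations X)"
  shows "u \<circ> v \<in> carrier (generated_transformations X)"
  using assms generated_subsemigroup.mult[of u transformations X v]
  by (simp add: generated_transformations_def)

lemma generated_transformations_funpow:
  assumes "u \<in> carrier (generated_transformations X)" "id \<in> carrier (generated_transformations X)"
  shows "u ^^ n \<in> carrier (generated_transformations X)"
  by (induction n) (simp_all only: funpow.simps assms generated_transformations_comp)

lemma carrier_semigroup_generated_transformations: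
  "X \<noteq> {} \<Longrightarrow> carrier_semigroup (generated_transformations X)"
  by standard (auto intro: generated_transformations_incl generated_transformations_comp)

lemma generated_subsemigroup_generated_transformations:
  "generated_subsemigroup (generated_transformations X) X = carrier (generated_transformations X)"
  unfolding generated_transformations_def
  by (simp, rule generated_subsemigroup_cong) simp

lemma funpow_left_inverse:
  fixes b c :: "'x \<Rightarrow> 'x"
  assumes "b \<circ> c = id"
  shows "(b ^^ n) \<circ> (c ^^ n) = id"
proof (induction n)
  case (Suc n)
  have "(b ^^ Suc n) \<circ> (c ^^ Suc n) = (b ^^ n) \<circ> (b \<circ> c) \<circ> (c ^^ n)"
    by (subst funpow_Suc_right) (simp only: funpow.simps comp_assoc)
  then show ?case by (simp only: Suc assms comp_id)
qed simp

lemma simple_generated_transformations: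
  fixes c y :: "'x \<Rightarrow> 'x"
  defines "Q \<equiv> generated_transformations {c, y}"
  assumes b: "b \<in> carrier Q" and id: "id \<in> carrier Q" and b_c: "b \<circ> c = id" and "c \<noteq> id"
    and y: "y \<circ> (c ^^ L0) = c ^^ M0"
  shows "simple_semigroup Q"
proof -
  have c: "c \<in> carrier Q"
    unfolding Q_def by (rule generated_transformations_incl) simp
  have shift: "\<exists>L M. u \<circ> (c ^^ L) = c ^^ M"
    if "u \<in> generated_subsemigroup transformations {c, y}" for u
    using that
  proof induction
    case (incl u)
    moreover have "c \<circ> (c ^^ 0) = c ^^ 1" by simp
    ultimately show ?case using y by blast
  next
    case (mult u v)
    then obtain L M L' M' where u: "u \<circ> (c ^^ L) = c ^^ M" and v: "v \<circ> (c ^^ L') = c ^^ M'"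
      by blast
    \<comment> \<open>The padding \<open>c ^^ L\<close> survives \<open>v\<close> as part of a
      shift; since powers of \<open>c\<close> commute, it can be moved next to \<open>u\<close>,
      which absorbs it.\<close>
    have "(u \<circ> v) \<circ> (c ^^ (L' + L)) = u \<circ> (v \<circ> (c ^^ L')) \<circ> (c ^^ L)"
      by (simp only: funpow_add comp_assoc)
    also have "\<dots> = u \<circ> (c ^^ (M' + L))"
      by (simp only: v funpow_add comp_assoc)
    also have "\<dots> = (u \<circ> (c ^^ L)) \<circ> (c ^^ M')"
      by (simp only: add.commute[of M'] funpow_add comp_assoc)
    also have "\<dots> = c ^^ (M + M')" by (simp only: u funpow_add)
    finally show ?case unfolding mult_transformations by blast
  qed
  have split: "\<exists>s\<in>carrier Q. \<exists>t\<in>carrier Q. s \<circ> u \<circ> t = id" if "u \<in> carrier Q" for u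
  proof -
    obtain L M where "u \<circ> (c ^^ L) = c ^^ M"
      using \<open>u \<in> carrier Q\<close> shift[of u] unfolding Q_def generated_transformations_def by auto
    then have "(b ^^ M) \<circ> u \<circ> (c ^^ L) = id"
      using funpow_left_inverse[OF b_c] by (simp add: comp_assoc)
    then show ?thesis
      using b c id generated_transformations_funpow unfolding Q_def by blast
  qed
  show ?thesis
    unfolding simple_semigroup_def
  proof (intro conjI notI allI impI)
    assume "has_zero Q"
    then obtain z where z: "z \<in> carrier Q" "\<And>s. s \<in> carrier Q \<Longrightarrow> z \<circ> s = z \<and> s \<circ> z = z"
      unfolding has_zero_def by (auto simp: Q_def)
    \<comment> \<open>Absorption collapses the left side of
      \<open>s \<circ> z \<circ> t = id\<close> to \<open>z\<close>.\<close>
    then have "z = id" using split[OF z(1)] by metis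
    then show False using z(2)[OF c] \<open>c \<noteq> id\<close> by simp
  next
    fix I assume I: "semigroup_ideal Q I"
    then have ideal: "s \<circ> x \<in> I \<and> x \<circ> s \<in> I" if "s \<in> carrier Q" "x \<in> I" for s x
      using that unfolding semigroup_ideal_def by (simp add: Q_def)
    obtain u where "u \<in> I" "u \<in> carrier Q" using I unfolding semigroup_ideal_def by blast
    then have "id \<in> I" using split[of u] ideal by metis
    then have "carrier Q \<subseteq> I" using ideal[of _ id] by auto
    then show "I = carrier Q" using I unfolding semigroup_ideal_def by blast
  qed
qed

section \<open>The two generators\<close>

definition shift_up :: "nat \<times> 'y \<Rightarrow> nat \<times> 'y" where
  "shift_up = apfst Suc"

fun shift_down :: "('y \<Rightarrow> 'y) \<Rightarrow> nat \<times> 'y \<Rightarrow> nat \<times> 'y" where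
  "shift_down \<phi> (0, t) = (0, \<phi> t)"
| "shift_down \<phi> (Suc n, t) = (n, t)"

text \<open>One shift up from level 0 meets the swap, which returns to level 0, where
  \<open>shift_down\<close> applies \<open>\<phi>\<close>; two shifts up meet \<open>\<tau>\<close>.
  Fixing the levels from 3 on makes the second generator a pure shift there.\<close>

fun exchange :: "('y \<Rightarrow> 'y) \<Rightarrow> nat \<times> 'y \<Rightarrow> nat \<times> 'y" where
  "exchange \<tau> (0, t) = (1, t)"
| "exchange \<tau> (Suc 0, t) = (0, t)"
| "exchange \<tau> (Suc (Suc 0), t) = (2, \<tau> t)"
| "exchange \<tau> (Suc (Suc (Suc n)), t) = (Suc (Suc (Suc n)), t)"

lemma shift_up_apply [simp]: "shift_up (n, t) = (Suc n, t)"
  by (simp add: shift_up_def)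

lemma shift_down_shift_up: "shift_down \<phi> \<circ> shift_up = id"
  by auto

lemma exchange_exchange:
  fixes \<tau> :: "'y \<Rightarrow> 'y"
  assumes "\<tau> \<circ> \<tau> = id"
  shows "exchange \<tau> \<circ> exchange \<tau> = id"
proof
  fix x :: "nat \<times> 'y"
  have "\<tau> (\<tau> t) = t" for t using fun_cong[OF assms, of t] by simp
  then show "(exchange \<tau> \<circ> exchange \<tau>) x = id x"
    by (cases "(\<tau>, x)" rule: exchange.cases) (auto simp: numeral_2_eq_2)
qed

lemma exchange_shift_up: "exchange \<tau> \<circ> shift_up ^^ 3 = shift_up ^^ 3"
  by (auto simp: numeral_3_eq_3)

definition \<phi>_low :: "('y \<Rightarrow> 'y) \<Rightarrow> ('y \<Rightarrow> 'y) \<Rightarrow> nat \<times> 'y \<Rightarrow> nat \<times> 'y" where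
  "\<phi>_low \<phi> \<tau> = shift_down \<phi> \<circ> exchange \<tau> \<circ> shift_up"

definition \<tau>_low :: "('y \<Rightarrow> 'y) \<Rightarrow> ('y \<Rightarrow> 'y) \<Rightarrow> nat \<times> 'y \<Rightarrow> nat \<times> 'y" where
  "\<tau>_low \<phi> \<tau> = shift_down \<phi> \<circ> shift_down \<phi> \<circ> exchange \<tau> \<circ> shift_up \<circ> shift_up"

text \<open>Level 1 is lifted to level 2, where \<open>\<tau>\<close> acts; this side effect has to
  be cancelled in \<open>select\<close>.\<close>

lemma \<phi>_low_apply:
  "\<phi>_low \<phi> \<tau> (0, t) = (0, \<phi> t)"
  "\<phi>_low \<phi> \<tau> (Suc 0, t) = (Suc 0, \<tau> t)"
  "\<phi>_low \<phi> \<tau> (Suc (Suc n), t) = (Suc (Suc n), t)"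
  by (simp_all add: \<phi>_low_def numeral_2_eq_2)

lemma \<tau>_low_apply:
  "\<tau>_low \<phi> \<tau> (0, t) = (0, \<tau> t)"
  "\<tau>_low \<phi> \<tau> (Suc n, t) = (Suc n, t)"
  by (simp_all add: \<tau>_low_def numeral_2_eq_2)

lemma \<phi>_low_funpow:
  "(\<phi>_low \<phi> \<tau> ^^ m) (0, t) = (0, (\<phi> ^^ m) t)"
  "(\<phi>_low \<phi> \<tau> ^^ m) (Suc 0, t) = (Suc 0, (\<tau> ^^ m) t)"
  "(\<phi>_low \<phi> \<tau> ^^ m) (Suc (Suc n), t) = (Suc (Suc n), t)"
  by (induction m) (simp_all add: \<phi>_low_apply)

definition two_generator_semigroup ::
    "('y \<Rightarrow> 'y) \<Rightarrow> ('y \<Rightarrow> 'y) \<Rightarrow> (nat \<times> 'y \<Rightarrow> nat \<times> 'y) monoid" where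
  "two_generator_semigroup \<phi> \<tau> =
    generated_transformations {shift_up, exchange \<tau> \<circ> shift_down \<phi>}"

lemma two_generator_semigroup_comp:
  assumes "u \<in> carrier (two_generator_semigroup \<phi> \<tau>)" "v \<in> carrier (two_generator_semigroup \<phi> \<tau>)"
  shows "u \<circ> v \<in> carrier (two_generator_semigroup \<phi> \<tau>)"
  using assms unfolding two_generator_semigroup_def by (rule generated_transformations_comp)

lemma two_generator_semigroup_mem:
  assumes "\<tau> \<circ> \<tau> = id"
  shows shift_up_mem: "shift_up \<in> carrier (two_generator_semigroup \<phi> \<tau>)"
    and exchange_mem: "exchange \<tau> \<in> carrier (two_generator_semigroup \<phi> \<tau>)"
    and id_mem: "id \<in> carrier (two_generator_semigroup \<phi> \<tau>)"
    and shift_down_mem: "shift_down \<phi> \<in> carrier (two_generator_semigroup \<phi> \<tau>)"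
proof -
  let ?Q = "two_generator_semigroup \<phi> \<tau>" and ?y = "exchange \<tau> \<circ> shift_down \<phi>"
  show c: "shift_up \<in> carrier ?Q"
    unfolding two_generator_semigroup_def by (rule generated_transformations_incl) simp
  have y: "?y \<in> carrier ?Q"
    unfolding two_generator_semigroup_def by (rule generated_transformations_incl) simp
  have "?y \<circ> shift_up = exchange \<tau>"
    using shift_down_shift_up[of \<phi>] by (simp add: comp_assoc)
  then show p: "exchange \<tau> \<in> carrier ?Q"
    using two_generator_semigroup_comp[OF y c] by simp
  show "id \<in> carrier ?Q"
    using two_generator_semigroup_comp[OF p p] by (simp add: exchange_exchange[OF assms])
  have "exchange \<tau> \<circ> ?y = shift_down \<phi>"
    by (simp add: comp_assoc[symmetric] exchange_exchange[OF assms])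
  then show "shift_down \<phi> \<in> carrier ?Q"
    using two_generator_semigroup_comp[OF p y] by simp
qed

lemma low_mem:
  assumes "\<tau> \<circ> \<tau> = id"
  shows "\<phi>_low \<phi> \<tau> \<in> carrier (two_generator_semigroup \<phi> \<tau>)"
    and "\<tau>_low \<phi> \<tau> \<in> carrier (two_generator_semigroup \<phi> \<tau>)"
  unfolding \<phi>_low_def \<tau>_low_def
  by (intro two_generator_semigroup_comp two_generator_semigroup_mem assms)+

lemma carrier_semigroup_two_generator_semigroup:
  "carrier_semigroup (two_generator_semigroup \<phi> \<tau>)"
  unfolding two_generator_semigroup_def by (rule carrier_semigroup_generated_transformations) simp

lemma two_generated_two_generator_semigroup: "two_generated (two_generator_semigroup \<phi> \<tau>)"
  unfolding two_generated_def two_generator_semigroup_def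
  by (rule bexI[of _ shift_up], rule bexI[of _ "exchange \<tau> \<circ> shift_down \<phi>"])
    (simp_all add: generated_subsemigroup_generated_transformations generated_transformations_incl)

lemma countable_two_generator_semigroup: "countable (carrier (two_generator_semigroup \<phi> \<tau>))"
  by (simp add: two_generator_semigroup_def generated_transformations_def
      countable_generated_subsemigroup)

lemma simple_two_generator_semigroup:
  fixes \<tau> :: "'y \<Rightarrow> 'y"
  assumes "\<tau> \<circ> \<tau> = id"
  shows "simple_semigroup (two_generator_semigroup \<phi> \<tau>)"
  unfolding two_generator_semigroup_def
proof (rule simple_generated_transformations)
  show "shift_down \<phi> \<circ> shift_up = id" by (rule shift_down_shift_up)
  show "shift_up \<noteq> id"
    by (metis id_apply n_not_Suc_n prod.inject shift_up_apply)
  \<comment> \<open>One shift is cancelled by \<open>shift_down\<close>; the other three reach the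
    levels fixed by \<open>exchange\<close>.\<close>
  have "shift_up ^^ 4 = (shift_up :: nat \<times> 'y \<Rightarrow> _) \<circ> shift_up ^^ 3" by (simp add: eval_nat_numeral)
  then have "exchange \<tau> \<circ> shift_down \<phi> \<circ> shift_up ^^ 4
      = exchange \<tau> \<circ> (shift_down \<phi> \<circ> shift_up) \<circ> shift_up ^^ 3"
    by (simp only: comp_assoc)
  then show "exchange \<tau> \<circ> shift_down \<phi> \<circ> shift_up ^^ 4 = shift_up ^^ 3"
    by (simp add: shift_down_shift_up exchange_shift_up)
qed (use two_generator_semigroup_mem[OF assms] in \<open>simp_all add: two_generator_semigroup_def\<close>)

section \<open>Coding a sequence of maps\<close>

text \<open>The components are the switch, the counter and the point on which the coded maps
  act.\<close>

type_synonym 'z code = "bool \<times> nat \<times> 'z"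

text \<open>Applying a map also resets switch and counter, ready for the next selection. Map
  \<open>i\<close> is called with counter \<open>2 * i + 1\<close>, from which \<open>div 2\<close>
  recovers \<open>i\<close>.\<close>

fun step :: "(nat \<Rightarrow> 'z \<Rightarrow> 'z) \<Rightarrow> 'z code \<Rightarrow> 'z code" where
  "step f (False, k, z) = (False, Suc k, z)"
| "step f (True, k, z) = (False, 0, f (k div 2) z)"

definition flip :: "'z code \<Rightarrow> 'z code" where
  "flip = apfst Not"

lemma flip_apply [simp]: "flip (s, k, z) = (\<not> s, k, z)"
  by (simp add: flip_def)

lemma flip_flip: "flip \<circ> flip = id"
  by auto

lemma step_funpow: "(step f ^^ m) (False, k, z) = (False, k + m, z)"
  by (induction m) simp_all

text \<open>
  The odd exponent makes the number of factors \<open>\<phi>_low\<close> even, so that their actions by the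
  involution \<open>flip\<close> on level \<open>1\<close> cancel.
\<close>

definition select :: "(nat \<Rightarrow> 'z \<Rightarrow> 'z) \<Rightarrow> nat \<Rightarrow> nat \<times> 'z code \<Rightarrow> nat \<times> 'z code" where
  "select f i = \<phi>_low (step f) flip \<circ> \<tau>_low (step f) flip \<circ> \<phi>_low (step f) flip ^^ Suc (2 * i)"

text \<open>The power of \<open>\<phi>_low\<close> counts to \<open>2 * i + 1\<close>,
  \<open>\<tau>_low\<close> turns the switch on, and the last \<open>\<phi>_low\<close> applies
  \<open>f i\<close>.\<close>

lemma select_base: "select f i (0, False, 0, z) = (0, False, 0, f i z)"
  by (simp add: select_def \<phi>_low_funpow \<phi>_low_apply \<tau>_low_apply step_funpow del: funpow.simps)

lemma select_into_base: "\<exists>z. select f i (0, t) = (0, False, 0, z)"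
proof -
  obtain s k w where t: "t = (s, k, w)" by (cases t)
  \<comment> \<open>The exponent is positive, and its first \<open>step\<close> already turns the
    switch off from any state; the remaining ones only count.\<close>
  have "\<exists>j z. (step f ^^ Suc (2 * i)) t = (False, j, z)"
    by (cases s) (simp_all add: t funpow_Suc_right step_funpow del: funpow.simps)
  then show ?thesis
    by (auto simp: select_def \<phi>_low_funpow \<phi>_low_apply \<tau>_low_apply simp del: funpow.simps)
qed

lemma select_Suc: "select f i (Suc n, t) = (Suc n, t)"
proof (cases n)
  case 0
  have "(flip ^^ (2 * m)) u = u" for m and u :: "'a code"
    by (cases u; induction m) simp_all
  \<comment> \<open>The outer \<open>\<phi>_low\<close> contributes the last of the
    \<open>2 * Suc i\<close> flips.\<close>
  from this[of "Suc i" t] have "flip ((flip ^^ Suc (2 * i)) t) = t" by simp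
  then show ?thesis
    by (simp add: 0 select_def \<phi>_low_funpow \<phi>_low_apply \<tau>_low_apply del: funpow.simps)
next
  case (Suc m)
  then show ?thesis
    by (simp add: select_def \<phi>_low_funpow \<phi>_low_apply \<tau>_low_apply del: funpow.simps)
qed

text \<open>The right factor retracts level \<open>0\<close> onto the points \<open>(0, False, 0, z)\<close> when \<open>f 0 = id\<close>.\<close>

definition embedding :: "(nat \<Rightarrow> 'z \<Rightarrow> 'z) \<Rightarrow> nat \<Rightarrow> nat \<times> 'z code \<Rightarrow> nat \<times> 'z code" where
  "embedding f i = select f i \<circ> select f 0"

lemma embedding_mem: "embedding f i \<in> carrier (two_generator_semigroup (step f) flip)"
proof -
  have "\<phi>_low (step f) flip ^^ m \<in> carrier (two_generator_semigroup (step f) flip)" for m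
    using low_mem(1)[OF flip_flip] id_mem[OF flip_flip] unfolding two_generator_semigroup_def
    by (rule generated_transformations_funpow)
  then show ?thesis
    unfolding embedding_def select_def by (intro two_generator_semigroup_comp low_mem flip_flip)
qed

text \<open>Above level 0 all these maps are the identity. On level 0 the rightmost
  \<open>select f 0\<close> lands on a base point; from there each \<open>select f i\<close> acts by
  \<open>f i\<close>, and the inner \<open>select f 0\<close> by \<open>id\<close>.\<close>

lemma embedding_comp:
  assumes "f 0 = id" and "f k = f i \<circ> f j"
  shows "embedding f i \<circ> embedding f j = embedding f k"
proof
  fix x :: "nat \<times> 'a code"
  obtain n t where x: "x = (n, t)" by (cases x)
  show "(embedding f i \<circ> embedding f j) x = embedding f k x"
  proof (cases n)
    case 0
    obtain z where "select f 0 (0, t) = (0, False, 0, z)" using select_into_base[of f 0 t] by blast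
    then show ?thesis by (simp add: x 0 embedding_def select_base assms)
  next
    case (Suc m)
    then show ?thesis by (simp add: x embedding_def select_Suc)
  qed
qed

lemma embedding_eqD:
  assumes "f 0 = id" and "embedding f i = embedding f j"
  shows "f i = f j"
proof
  fix z
  show "f i z = f j z"
    using fun_cong[OF assms(2), of "(0, False, 0, z)"] by (simp add: embedding_def select_base assms(1))
qed

text \<open>\<open>None\<close> is an adjoined unit; elements outside the carrier are treated like it.\<close>

definition left_translation :: "('a, 'b) monoid_scheme \<Rightarrow> 'a \<Rightarrow> 'a option \<Rightarrow> 'a option" where
  "left_translation P x z =
    Some (case z of None \<Rightarrow> x | Some q \<Rightarrow> if q \<in> carrier P then x \<otimes>\<^bsub>P\<^esub> q else x)"

text \<open>The inner map returns \<open>Some\<close> of \<open>y\<close> or of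
  \<open>y \<otimes> q\<close>, both in the carrier, so associativity applies.\<close>

lemma (in carrier_semigroup) left_translation_mult:
  assumes "x \<in> carrier S" "y \<in> carrier S"
  shows "left_translation S (x \<otimes> y) = left_translation S x \<circ> left_translation S y"
  using assms by (auto simp: left_translation_def fun_eq_iff m_closed m_assoc split: option.split)

text \<open>The value at the adjoined unit recovers \<open>x\<close>, even where left multiplication
  inside \<open>P\<close> is not faithful.\<close>

lemma left_translation_inject: "left_translation P x = left_translation P y \<Longrightarrow> x = y"
  by (drule fun_cong[of _ _ None]) (simp add: left_translation_def)

theorem theorem3p6:
  fixes P :: "('a, 'b) monoid_scheme"
  assumes "carrier_semigroup P"
    and "countably_generated P"
  shows "\<exists>(Q :: nat monoid) f. carrier_semigroup Q \<and> simple_semigroup Q \<and> two_generated Q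
           \<and> f \<in> mon P Q"
proof -
  interpret carrier_semigroup P by fact
  have countable: "countable (carrier P)"
    using assms(2) countable_generated_subsemigroup unfolding countably_generated_def by metis
  \<comment> \<open>Index 0 is reserved for the identity, as \<open>embedding_comp\<close> requires;
    hence the \<open>Suc\<close> in \<open>index\<close>.\<close>
  define f where "f i = (case i of 0 \<Rightarrow> id
      | Suc n \<Rightarrow> left_translation P (from_nat_into (carrier P) n))" for i
  define index where "index x = Suc (to_nat_on (carrier P) x)" for x
  have f_0: "f 0 = id" by (simp add: f_def)
  have f_index: "f (index x) = left_translation P x" if "x \<in> carrier P" for x
    using that countable by (simp add: f_def index_def)
  let ?R = "two_generator_semigroup (step f) flip"
  have "(embedding f \<circ> index) \<in> hom P ?R"
  proof (rule homI)
    fix x y assume xy: "x \<in> carrier P" "y \<in> carrier P"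
    then have "f (index (x \<otimes>\<^bsub>P\<^esub> y)) = f (index x) \<circ> f (index y)"
      by (simp add: f_index m_closed left_translation_mult)
    from embedding_comp[of f, OF f_0 this]
    show "(embedding f \<circ> index) (x \<otimes>\<^bsub>P\<^esub> y) = (embedding f \<circ> index) x \<otimes>\<^bsub>?R\<^esub> (embedding f \<circ> index) y"
      by (simp add: two_generator_semigroup_def)
  qed (simp add: embedding_mem)
  moreover have "inj_on (embedding f \<circ> index) (carrier P)"
    by (rule inj_onI) (metis comp_apply embedding_eqD f_0 f_index left_translation_inject)
  moreover obtain Q :: "nat monoid" and g where Q: "carrier_semigroup Q" and g: "g \<in> iso ?R Q"
    using nat_copy[OF carrier_semigroup_two_generator_semigroup countable_two_generator_semigroup]
    by blast
  ultimately have "g \<circ> (embedding f \<circ> index) \<in> mon P Q"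
    by (intro mon_compose[of _ _ ?R]) (simp_all add: mon_def iso_def bij_betw_def)
  moreover have "simple_semigroup Q"
    using carrier_semigroup_two_generator_semigroup g simple_two_generator_semigroup[OF flip_flip]
    by (rule iso_simple_semigroup)
  moreover have "two_generated Q"
    using carrier_semigroup_two_generator_semigroup g two_generated_two_generator_semigroup
    by (rule iso_two_generated)
  ultimately show ?thesis using Q by blast
qed

end
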